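(* For any integers $t\ge s\ge 2$, $$\hat r_{\mathrm{edge}}(2K_2^{\prec},K_{s,t}^{\prec})=st+s+t .$$
   Context: All graphs are finite, simple and undirected. An edge-ordered graph $G^{\prec}$ is a pair $(G,\prec)$ of a graph $G$ and a linear order $\prec$ on $E(G)$. $G^{\prec}$ is an edge-ordered subgraph of $H^{\prec}$ if $G$ is a subgraph of $H$ and the edge order of $G$ is the restriction of the edge order of $H$. Two edge-ordered graphs are isomorphic if there is a graph isomorphism whose induced map on edges preserves the edge orders. An edge-ordered copy of $G^{\prec}$ in $F^{\prec}$ is an edge-ordered subgraph of $F^{\prec}$ isomorphic to $G^{\prec}$. For edge-ordered graphs $G^{\prec},H^{\prec}$, the size edge-ordered Ramsey number $\hat r_{\mathrm{edge}}(G^{\prec},H^{\prec})$ is the minimum number $N$ such that there exists an edge-ordered graph $F^{\prec}$ with $N$ edges such that every red/blue coloring of the edges of $F^{\prec}$ contains a red edge-ordered copy of $G^{\prec}$ or a blue edge-ordered copy of $H^{\prec}$. $2K_2^{\prec}$ is a matching with $2$ edges equipped with a linear order on its edges. $K_{s,t}^{\prec}$ is the complete bipartite graph with partite sets $A=\{u_1,\dots,u_s\}$ and $B=\{v_1,\dots,v_t\}$ and the vertex-lexicographic edge order: $u_iv_j\prec u_kv_l$ iff $i<k$, or $i=k$ and $j<l$ (for $1\le i,k\le s$, $1\le j,l\le t$). *)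

theory Defs
  imports Main "HOL-Library.Extended_Nat"
begin

record 'v eograph =
  verts :: "'v set"
  edges :: "'v set set"
  eord :: "('v set \<times> 'v set) set"

text \<open>A finite simple undirected graph together with a strict linear order on its edges;
  \<^term>\<open>(e, f) \<in> eord G\<close> means that \<open>e\<close> precedes \<open>f\<close>. The order relation is required to live on
  the edge set, since \<^const>\<open>strict_linear_order_on\<close> does not constrain its field.\<close>

definition edge_ordered_graph :: "'v eograph \<Rightarrow> bool" where
  "edge_ordered_graph G \<longleftrightarrow>
     finite (verts G) \<and>
     (\<forall>e\<in>edges G. e \<subseteq> verts G \<and> card e = 2) \<and>
     eord G \<subseteq> edges G \<times> edges G \<and>
     strict_linear_order_on (edges G) (eord G)"

definition eo_subgraph :: "'v eograph \<Rightarrow> 'v eograph \<Rightarrow> bool" where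
  "eo_subgraph G H \<longleftrightarrow>
     verts G \<subseteq> verts H \<and> edges G \<subseteq> edges H \<and>
     eord G = eord H \<inter> (edges G \<times> edges G)"

definition eo_isomorphic :: "'v eograph \<Rightarrow> 'w eograph \<Rightarrow> bool" where
  "eo_isomorphic G H \<longleftrightarrow>
     (\<exists>\<phi>. bij_betw \<phi> (verts G) (verts H) \<and>
       (\<forall>x\<in>verts G. \<forall>y\<in>verts G. {x, y} \<in> edges G \<longleftrightarrow> {\<phi> x, \<phi> y} \<in> edges H) \<and>
       (\<forall>e\<in>edges G. \<forall>f\<in>edges G. (e, f) \<in> eord G \<longleftrightarrow> (\<phi> ` e, \<phi> ` f) \<in> eord H))"

definition eo_copy :: "'v eograph \<Rightarrow> 'w eograph \<Rightarrow> 'v eograph \<Rightarrow> bool" where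
  "eo_copy C G F \<longleftrightarrow> edge_ordered_graph C \<and> eo_subgraph C F \<and> eo_isomorphic C G"

datatype colour = Red | Blue

definition eo_arrows :: "'v eograph \<Rightarrow> 'a eograph \<Rightarrow> 'b eograph \<Rightarrow> bool" where
  "eo_arrows F G H \<longleftrightarrow>
     (\<forall>c :: 'v set \<Rightarrow> colour.
        (\<exists>C. eo_copy C G F \<and> (\<forall>e\<in>edges C. c e = Red)) \<or>
        (\<exists>C. eo_copy C H F \<and> (\<forall>e\<in>edges C. c e = Blue)))"

text \<open>Host graphs have vertices in \<^typ>\<open>nat\<close>, which covers all finite graphs up to isomorphism.
  The value is \<open>\<infinity>\<close> if there is no suitable host graph, and otherwise the infimum
  is attained, i.e. it is a minimum.\<close>

definition size_edge_ordered_ramsey :: "'a eograph \<Rightarrow> 'b eograph \<Rightarrow> enat" where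
  "size_edge_ordered_ramsey G H =
     Inf {enat (card (edges F)) | F :: nat eograph. edge_ordered_graph F \<and> eo_arrows F G H}"

definition is_2K2 :: "'v eograph \<Rightarrow> bool" where
  "is_2K2 M \<longleftrightarrow>
     edge_ordered_graph M \<and> verts M = \<Union> (edges M) \<and> card (edges M) = 2 \<and>
     (\<forall>e\<in>edges M. \<forall>f\<in>edges M. e \<noteq> f \<longrightarrow> e \<inter> f = {})"

text \<open>The vertex \<open>u\<^sub>i\<close> is \<^term>\<open>Inl i\<close> and \<open>v\<^sub>j\<close> is \<^term>\<open>Inr j\<close>.\<close>

definition complete_bipartite_lex :: "nat \<Rightarrow> nat \<Rightarrow> (nat + nat) eograph" where
  "complete_bipartite_lex s t = \<lparr>
     verts = Inl ` {1..s} \<union> Inr ` {1..t},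
     edges = {{Inl i, Inr j} | i j. i \<in> {1..s} \<and> j \<in> {1..t}},
     eord = {({Inl i, Inr j}, {Inl k, Inr l}) | i j k l.
       i \<in> {1..s} \<and> k \<in> {1..s} \<and> j \<in> {1..t} \<and> l \<in> {1..t} \<and> (i < k \<or> i = k \<and> j < l)}\<rparr>"

lemma edge_ordered_graph_complete_bipartite_lex:
  "edge_ordered_graph (complete_bipartite_lex s t)"
proof -
  have *: "{Inl i, Inr j} = {Inl k, Inr l} \<longleftrightarrow> i = k \<and> j = l" for i j k l :: nat
    by (auto simp: doubleton_eq_iff)
  show ?thesis
    unfolding edge_ordered_graph_def complete_bipartite_lex_def strict_linear_order_on_def
    apply (simp, intro conjI)
    subgoal by auto
    subgoal by blast
    subgoal unfolding trans_def by (clarsimp simp: *) (metis less_trans)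
    subgoal unfolding irrefl_def by (auto simp: *)
    subgoal unfolding total_on_def by (clarsimp simp: *) (metis linorder_neqE_nat)
    done
qed

lemma is_2K2_example:
  "is_2K2 \<lparr>verts = {0, 1, 2, 3 :: nat}, edges = {{0, 1}, {2, 3}}, eord = {({0, 1}, {2, 3})}\<rparr>"
proof -
  have "{0, 1} \<noteq> {2, 3 :: nat}"
    by (simp add: doubleton_eq_iff)
  then show ?thesis
    unfolding is_2K2_def edge_ordered_graph_def strict_linear_order_on_def
    by (auto simp: trans_def irrefl_def total_on_def)
qed

end

theory Submission
  imports Defs "HOL-Library.Nat_Bijection"
begin

text \<open>
  The red edges of a colouring without a red \<open>2K\<^sub>2\<close> meet pairwise. So a host that arrows the pair
  contains, for every vertex \<open>x\<close>, an ordered copy of \<open>K\<^sub>s\<^sub>,\<^sub>t\<close> avoiding \<open>x\<close>: colour exactly the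
  edges at \<open>x\<close> red. For a bipartite host the converse holds too, since pairwise meeting edges of
  a bipartite graph form a star.

  \<^bold>\<open>Upper bound.\<close> The lexicographic \<open>K\<^sub>s\<^sub>+\<^sub>1\<^sub>,\<^sub>t\<^sub>+\<^sub>1\<close> without its last edge has
  \<open>(s + 1) (t + 1) - 1 = s t + s + t\<close> edges. Whichever vertex is deleted, deleting also an end of
  the missing edge on the opposite side leaves a complete lexicographic \<open>K\<^sub>s\<^sub>,\<^sub>t\<close>
  (\<open>eo_subgraph_skip\<close>, \<open>eo_arrows_punctured_biclique\<close>).

  \<^bold>\<open>Lower bound.\<close> The edge order enters through one consequence only. In an ordered copy with
  sides \<open>A\<close>, \<open>B\<close>, the edges at one vertex of \<open>A\<close> all precede the edges at another, and therefore
  two copies cannot overlap in a \<open>K\<^sub>2\<^sub>,\<^sub>2\<close> whose sides play exchanged roles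
  (\<open>lex_blocks_not_swapped\<close>). For unordered graphs and \<open>t = s + 1\<close> the bound is false:
  \<open>K\<^sub>t\<^sub>,\<^sub>t\<close> has only \<open>s t + t\<close> edges, and deleting any vertex leaves a \<open>K\<^sub>s\<^sub>,\<^sub>t\<close>.
  The rest is a count in the union \<open>E\<close> of all copies. Take a vertex \<open>a\<close> of degree at least \<open>t\<close> and a copy \<open>(A, B)\<close> avoiding it.

  If \<open>A\<close>, \<open>B\<close> and \<open>a\<close> exhaust the vertices, then every copy that avoids some other vertex must use
  \<open>a\<close>, and whatever it does not share with \<open>(A, B)\<close> is either at \<open>a\<close> or inside \<open>A\<close> or inside
  \<open>B\<close>. Counting these extra edges for copies that avoid two well chosen vertices gives \<open>s + t\<close> of them
  (\<open>apex_bound\<close>).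

  If there is another vertex \<open>b\<close> outside, then \<open>(A, B)\<close> with the stars of \<open>a\<close> and \<open>b\<close> already has
  at least \<open>s t + t + s - 1\<close> edges. A smaller \<open>E\<close> than claimed consists of exactly these edges,
  with \<open>a\<close> adjacent to \<open>b\<close> and with degrees \<open>t\<close> and \<open>s\<close> (\<open>two_outside\<close>). This rigidity holds for
  every vertex of degree at least \<open>t\<close>, and it forces a triangle into a bipartite copy
  (\<open>card_E_ge\<close>).
\<close>

section \<open>Complete bipartite edge sets\<close>

definition bip :: "'v set \<Rightarrow> 'v set \<Rightarrow> 'v set set" where
  "bip A B = (\<lambda>(x, y). {x, y}) ` (A \<times> B)"

lemma bipI: "x \<in> A \<Longrightarrow> y \<in> B \<Longrightarrow> {x, y} \<in> bip A B"
  by (auto simp: bip_def)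

lemma bipI': "x \<in> A \<Longrightarrow> y \<in> B \<Longrightarrow> {y, x} \<in> bip A B"
  by (simp add: bipI insert_commute)

lemma bipE:
  assumes "e \<in> bip A B"
  obtains x y where "x \<in> A" "y \<in> B" "e = {x, y}"
  using assms by (auto simp: bip_def)

lemma doubleton_in_bip: "{x, y} \<in> bip A B \<longleftrightarrow> x \<in> A \<and> y \<in> B \<or> x \<in> B \<and> y \<in> A"
  by (auto simp: bip_def image_iff doubleton_eq_iff)

lemma bip_meets: "e \<in> bip A B \<Longrightarrow> e \<inter> A \<noteq> {} \<and> e \<inter> B \<noteq> {} \<and> e \<subseteq> A \<union> B"
  by (auto simp: bip_def)

lemma finite_bip: "finite A \<Longrightarrow> finite B \<Longrightarrow> finite (bip A B)"
  by (simp add: bip_def)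

lemma card_bip:
  assumes "A \<inter> B = {}"
  shows "card (bip A B) = card A * card B"
proof -
  have "inj_on (\<lambda>(x, y). {x, y}) (A \<times> B)"
    using assms by (auto simp: inj_on_def doubleton_eq_iff)
  then show ?thesis
    by (simp add: bip_def card_image card_cartesian_product)
qed

lemma card_Int_three:
  assumes "finite S" "S \<subseteq> insert x (A \<union> B)" "A \<inter> B = {}" "x \<notin> A \<union> B"
  shows "card S = card (S \<inter> A) + card (S \<inter> B) + (if x \<in> S then 1 else 0)"
proof -
  have "S = (S \<inter> A) \<union> (S \<inter> B) \<union> (S \<inter> {x})"
    using assms by auto
  then have "card S = card ((S \<inter> A) \<union> (S \<inter> B) \<union> (S \<inter> {x}))"
    by simp
  also have "\<dots> = card ((S \<inter> A) \<union> (S \<inter> B)) + card (S \<inter> {x})"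
    using assms by (intro card_Un_disjoint) auto
  also have "card ((S \<inter> A) \<union> (S \<inter> B)) = card (S \<inter> A) + card (S \<inter> B)"
    using assms by (intro card_Un_disjoint) auto
  finally show ?thesis
    by simp
qed

section \<open>Families of bicliques that no single vertex meets\<close>

text \<open>The combinatorial residue of an arrowing host: the pairs in \<open>P\<close> are the sides of its copies, of
the edge order only \<open>no_swap\<close> is kept, and vertices in no copy do not occur.\<close>

locale unstabbed_bicliques =
  fixes P :: "('v set \<times> 'v set) set" and s t :: nat
  assumes s_ge_2: "2 \<le> s" and s_le_t: "s \<le> t"
    and sides: "(A, B) \<in> P \<Longrightarrow> A \<inter> B = {} \<and> card A = s \<and> card B = t"
    and avoid: "\<exists>A B. (A, B) \<in> P \<and> v \<notin> A \<union> B"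
    and no_swap: "(A, B) \<in> P \<Longrightarrow> (A', B') \<in> P \<Longrightarrow> card (A' \<inter> B) \<le> 1 \<or> card (B' \<inter> A) \<le> 1"
    and finite_edges: "finite (\<Union>(A, B)\<in>P. bip A B)"
begin

definition E :: "'v set set" where
  "E = (\<Union>(A, B)\<in>P. bip A B)"

definition N :: "'v \<Rightarrow> 'v set" where
  "N x = {y. {x, y} \<in> E}"

definition star :: "'v \<Rightarrow> 'v set set" where
  "star x = {e \<in> E. x \<in> e}"

lemma finite_E: "finite E"
  using finite_edges by (simp add: E_def)

lemma finite_sides: "(A, B) \<in> P \<Longrightarrow> finite A \<and> finite B"
  using sides[of A B] s_ge_2 s_le_t by (auto intro: card_ge_0_finite)

lemma bip_subset_E: "(A, B) \<in> P \<Longrightarrow> bip A B \<subseteq> E"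
  by (auto simp: E_def)

lemma E_doubleton:
  assumes "e \<in> E"
  obtains x y where "e = {x, y}" "x \<noteq> y"
  using assms sides unfolding E_def by (fastforce elim!: bipE)

lemma N_irrefl: "x \<notin> N x"
proof
  assume "x \<in> N x"
  then have "{x} \<in> E" by (simp add: N_def)
  then show False by (metis E_doubleton doubleton_eq_iff insert_absorb2)
qed

lemma N_sym: "y \<in> N x \<longleftrightarrow> x \<in> N y"
  by (simp add: N_def insert_commute)

lemma star_eq: "star x = (\<lambda>y. {x, y}) ` N x"
proof
  show "star x \<subseteq> (\<lambda>y. {x, y}) ` N x"
  proof
    fix e assume e: "e \<in> star x"
    then obtain u v where "e = {u, v}"
      by (auto simp: star_def elim: E_doubleton)
    with e show "e \<in> (\<lambda>y. {x, y}) ` N x"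
      by (auto simp: star_def N_def insert_commute)
  qed
qed (auto simp: star_def N_def)

lemma card_star: "card (star x) = card (N x)"
  unfolding star_eq by (rule card_image) (auto simp: inj_on_def doubleton_eq_iff)

lemma finite_star: "finite (star x)"
  using finite_E by (simp add: star_def)

lemma finite_N: "finite (N x)"
proof -
  have "inj_on (\<lambda>y. {x, y}) (N x)"
    by (auto simp: inj_on_def doubleton_eq_iff)
  then show ?thesis
    using finite_star[of x] unfolding star_eq by (simp add: finite_image_iff)
qed

lemma N_left: "(A, B) \<in> P \<Longrightarrow> x \<in> A \<Longrightarrow> B \<subseteq> N x"
  using bip_subset_E by (force simp: N_def intro: bipI)

lemma N_right: "(A, B) \<in> P \<Longrightarrow> x \<in> B \<Longrightarrow> A \<subseteq> N x"
  using bip_subset_E by (force simp: N_def intro: bipI')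

lemma side_subset_Union_E:
  assumes "(A, B) \<in> P"
  shows "A \<union> B \<subseteq> \<Union>E"
proof -
  obtain a b where "a \<in> A" "b \<in> B"
    using sides[OF assms] s_ge_2 s_le_t by (metis card.empty equals0I le_zero_eq le_trans zero_neq_numeral)
  then show ?thesis
    using bip_subset_E[OF assms] by (blast intro: bipI)
qed

lemma N_subset_Union_E: "N x \<subseteq> \<Union>E"
  by (auto simp: N_def)

text \<open>Every vertex that occurs lies in a biclique of the family, and \<open>s\<close> is the smaller of the two
degrees there.\<close>

lemma min_degree:
  assumes "x \<in> \<Union>E"
  shows "s \<le> card (N x)"
proof -
  obtain A B where P: "(A, B) \<in> P" and x: "x \<in> A \<union> B"
    using assms by (fastforce simp: E_def elim!: bipE)
  show ?thesis
  proof (cases "x \<in> A")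
    case True
    then show ?thesis
      using card_mono[OF finite_N N_left[OF P]] sides[OF P] s_le_t by force
  next
    case False
    then show ?thesis
      using card_mono[OF finite_N N_right[OF P]] sides[OF P] x by force
  qed
qed

lemma degree_left:
  assumes "(A, B) \<in> P" "x \<in> A"
  shows "t \<le> card (N x)"
  using card_mono[OF finite_N N_left[OF assms]] sides[OF assms(1)] by simp

lemma star_Int: "a \<noteq> b \<Longrightarrow> star a \<inter> star b = {{a, b}} \<inter> E"
proof -
  have "e = {a, b}" if "a \<noteq> b" "e \<in> E" "a \<in> e" "b \<in> e" for e
    using that(2) by (rule E_doubleton) (use that in auto)
  then show "a \<noteq> b \<Longrightarrow> star a \<inter> star b = {{a, b}} \<inter> E"
    by (auto simp: star_def)
qed

section \<open>The case of a single vertex outside a biclique\<close>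

text \<open>The four products and the degree count pairwise disjoint sets of edges: those of the first
biclique, those at \<open>x\<close>, and those of the second biclique lying inside \<open>A\<close> or inside \<open>B\<close>.\<close>

lemma edge_count_over_biclique:
  assumes P: "(A, B) \<in> P" and P': "(A', B') \<in> P" and x: "x \<notin> A \<union> B"
  shows "s * t + card (N x) + card (A' \<inter> A) * card (B' \<inter> A) + card (A' \<inter> B) * card (B' \<inter> B)
    \<le> card E"
proof -
  let ?X = "bip (A' \<inter> A) (B' \<inter> A)" and ?Y = "bip (A' \<inter> B) (B' \<inter> B)"
  note d = sides[OF P] sides[OF P'] finite_sides[OF P] finite_sides[OF P']
  have fin: "finite (bip A B)" "finite ?X" "finite ?Y"
    using d by (auto intro!: finite_bip)
  have cards: "card (bip A B) = s * t" "card ?X = card (A' \<inter> A) * card (B' \<inter> A)"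
    "card ?Y = card (A' \<inter> B) * card (B' \<inter> B)"
    using d by (subst card_bip; auto)+
  have AB: "e \<inter> A \<noteq> {} \<and> e \<inter> B \<noteq> {} \<and> x \<notin> e" if "e \<in> bip A B" for e
    using bip_meets[OF that] x by blast
  have X: "e \<inter> A \<noteq> {} \<and> e \<subseteq> A" if "e \<in> ?X" for e
    using bip_meets[OF that] by blast
  have Y: "e \<inter> B \<noteq> {} \<and> e \<subseteq> B" if "e \<in> ?Y" for e
    using bip_meets[OF that] by blast
  have AB0: "A \<inter> B = {}"
    using d by simp
  have disj: "bip A B \<inter> star x = {}"
    using AB by (auto simp: star_def)
  have disj': "(bip A B \<union> star x) \<inter> ?X = {}"
    using AB X AB0 x unfolding star_def by blast
  have disj'': "(bip A B \<union> star x \<union> ?X) \<inter> ?Y = {}"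
    using AB X Y AB0 x unfolding star_def by blast
  have "?X \<subseteq> bip A' B'" "?Y \<subseteq> bip A' B'"
    by (auto simp: bip_def)
  then have "bip A B \<union> star x \<union> ?X \<union> ?Y \<subseteq> E"
    using bip_subset_E[OF P] bip_subset_E[OF P'] by (auto simp: star_def)
  then have "card (bip A B \<union> star x \<union> ?X \<union> ?Y) \<le> card E"
    using finite_E by (rule card_mono[rotated])
  then show ?thesis
    using disj disj' disj'' fin finite_star[of x] cards
    by (simp add: card_Un_disjoint card_star)
qed

text \<open>A copy has \<open>s + t\<close> vertices. If only \<open>s + t + 1\<close> occur and the copy avoids \<open>v\<close>, it uses all the
others, and this fixes how its sides can split \<open>A\<close> and \<open>B\<close>.\<close>

lemma avoiding_partition:
  assumes P: "(A, B) \<in> P" and P': "(A', B') \<in> P" and x: "x \<notin> A \<union> B"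
    and span: "\<Union>E \<subseteq> insert x (A \<union> B)" and v: "v \<in> A \<union> B" "v \<notin> A' \<union> B'"
  shows "x \<in> A' \<union> B'"
    and "card (A' \<inter> A) + card (A' \<inter> B) + (if x \<in> A' then 1 else 0) = s"
    and "card (B' \<inter> A) + card (B' \<inter> B) + (if x \<in> B' then 1 else 0) = t"
    and "card (A' \<inter> A) + card (B' \<inter> A) + (if v \<in> A then 1 else 0) = s"
    and "card (A' \<inter> B) + card (B' \<inter> B) + (if v \<in> B then 1 else 0) = t"
proof -
  note d = sides[OF P] sides[OF P'] finite_sides[OF P] finite_sides[OF P']
  have sub: "A' \<union> B' \<subseteq> insert x (A \<union> B) - {v}"
    using side_subset_Union_E[OF P'] span v by blast
  have "card (A' \<union> B') = s + t" "card (A \<union> B) = s + t"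
    using d by (simp_all add: card_Un_disjoint)
  then have "card (A' \<union> B') = card (insert x (A \<union> B) - {v})"
    using d x v by simp
  then have eq: "A' \<union> B' = insert x (A \<union> B) - {v}"
    using sub d by (intro card_subset_eq) auto
  have subA': "A' \<subseteq> insert x (A \<union> B)" and subB': "B' \<subseteq> insert x (A \<union> B)"
    using sub by blast+
  show "x \<in> A' \<union> B'"
    using eq x v by auto
  show "card (A' \<inter> A) + card (A' \<inter> B) + (if x \<in> A' then 1 else 0) = s"
    using card_Int_three[OF _ subA' _ x] d by simp
  show "card (B' \<inter> A) + card (B' \<inter> B) + (if x \<in> B' then 1 else 0) = t"
    using card_Int_three[OF _ subB' _ x] d by simp
  have "card A = card (A \<inter> A') + card (A \<inter> B') + (if v \<in> A then 1 else 0)"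
    using d v eq by (intro card_Int_three) auto
  then show "card (A' \<inter> A) + card (B' \<inter> A) + (if v \<in> A then 1 else 0) = s"
    using d by (simp add: Int_commute)
  have "card B = card (B \<inter> A') + card (B \<inter> B') + (if v \<in> B then 1 else 0)"
    using d v eq by (intro card_Int_three) auto
  then show "card (A' \<inter> B) + card (B' \<inter> B) + (if v \<in> B then 1 else 0) = t"
    using d by (simp add: Int_commute)
qed

text \<open>Here \<open>A \<union> {x}\<close> and \<open>B\<close> already span a \<open>K\<^sub>s\<^sub>+\<^sub>1\<^sub>,\<^sub>t\<close>, and a copy avoiding a vertex \<open>v\<close> of \<open>B\<close> has to
contribute the missing \<open>s\<close> edges, some at \<open>x\<close> and the others inside \<open>A\<close> or \<open>B\<close>. The count fails
only if that copy has the form \<open>(B - {v}, A \<union> {x})\<close>, which is possible for \<open>t = s + 1\<close>; this is the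
copy with exchanged sides that \<open>no_swap\<close> rules out.\<close>

lemma apex_joined_to_right_side:
  assumes P: "(A, B) \<in> P" and x: "x \<notin> A \<union> B" and span: "\<Union>E \<subseteq> insert x (A \<union> B)"
    and B: "B \<subseteq> N x"
  shows "s * t + s + t \<le> card E"
proof -
  have "card B = t" "t \<ge> 2"
    using sides[OF P] s_ge_2 s_le_t by auto
  then obtain v where v: "v \<in> B"
    by (metis card.empty equals0I not_numeral_le_zero)
  obtain A' B' where P': "(A', B') \<in> P" and v': "v \<notin> A' \<union> B'"
    using avoid by blast
  note d = sides[OF P] sides[OF P'] finite_sides[OF P] finite_sides[OF P']
  have vA: "v \<notin> A" and vAB: "v \<in> A \<union> B"
    using d v by auto
  \<comment> \<open>Unprimed letters count vertices that keep their side, primed ones those that change it.\<close>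
  define p p' q q' where "p = card (A' \<inter> A)" and "p' = card (A' \<inter> B)"
    and "q = card (B' \<inter> B)" and "q' = card (B' \<inter> A)"
  note part = avoiding_partition[OF P P' x span vAB v', folded p_def q_def p'_def q'_def]
  note count = edge_count_over_biclique[OF P P' x, folded p_def q_def p'_def q'_def]
  have deg: "t + card (S \<inter> A) \<le> card (N x)" if "S \<subseteq> N x" for S
  proof -
    have "card (B \<union> (S \<inter> A)) = t + card (S \<inter> A)"
      using d by (subst card_Un_disjoint) auto
    moreover have "card (B \<union> (S \<inter> A)) \<le> card (N x)"
      using that B by (intro card_mono finite_N) auto
    ultimately show ?thesis by simp
  qed
  show ?thesis
  proof (cases "x \<in> A'")
    case True
    then have "x \<notin> B'" using d by auto
    with True part v vA have eqs: "p + p' + 1 = s" "q' = p' + 1"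
      by auto
    have "t + q' \<le> card (N x)"
      using deg[OF N_left[OF P' True]] by (simp add: q'_def)
    moreover have "p \<le> p * q'"
      using eqs by simp
    ultimately show ?thesis
      using count eqs by linarith
  next
    case False
    then have xB': "x \<in> B'" using part(1) by simp
    with False part v vA have eqs: "p + p' = s" "q' = p'" "p' + q + 1 = t"
      by auto
    have "t + p \<le> card (N x)"
      using deg[OF N_right[OF P' xB']] by (simp add: p_def)
    moreover have "p' \<le> p * q' + p' * q"
    proof (cases "p = 0 \<and> q = 0")
      case True
      \<comment> \<open>Then \<open>p' = q' = s\<close>, so the second copy exchanges the sides.\<close>
      then show ?thesis
        using eqs no_swap[OF P P'] s_ge_2 by (simp add: p'_def q'_def)
    next
      case False
      then have "p' * 1 \<le> p' * (p + q)"
        by (intro mult_le_mono) auto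
      then show ?thesis
        using eqs by (simp add: algebra_simps)
    qed
    ultimately show ?thesis
      using count eqs by linarith
  qed
qed

text \<open>If \<open>x\<close> is not joined to all of \<open>B\<close>, it has a neighbour \<open>v\<close> in \<open>A\<close>, because its degree is at
least \<open>t\<close>. In a copy avoiding \<open>v\<close> the vertex \<open>x\<close> belongs to one of the sides and has the other side
and \<open>v\<close> as neighbours, hence degree at least \<open>t + 1\<close> or \<open>s + 1\<close>. Since \<open>x\<close> misses some vertex of \<open>B\<close>,
the copy cannot just replace \<open>v\<close> by \<open>x\<close>, so it also has edges inside \<open>A\<close> or \<open>B\<close>, and together these
make up \<open>s + t\<close>.\<close>

lemma apex_bound:
  assumes P: "(A, B) \<in> P" and x: "x \<notin> A \<union> B" and span: "\<Union>E \<subseteq> insert x (A \<union> B)"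
    and deg: "t \<le> card (N x)"
  shows "s * t + s + t \<le> card E"
proof (cases "B \<subseteq> N x")
  case True
  then show ?thesis
    using apex_joined_to_right_side[OF P x span] by simp
next
  case notB: False
  have "\<not> N x \<subseteq> B"
    using notB deg sides[OF P] finite_sides[OF P] by (metis card_seteq order_refl)
  moreover have "N x \<subseteq> A \<union> B"
    using N_subset_Union_E[of x] span N_irrefl[of x] by auto
  ultimately obtain v where v: "v \<in> A" "v \<in> N x"
    by auto
  obtain A' B' where P': "(A', B') \<in> P" and v': "v \<notin> A' \<union> B'"
    using avoid by blast
  note d = sides[OF P] sides[OF P'] finite_sides[OF P] finite_sides[OF P']
  have vB: "v \<notin> B" and vAB: "v \<in> A \<union> B"
    using d v by auto
  define p p' q q' where "p = card (A' \<inter> A)" and "p' = card (A' \<inter> B)"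
    and "q = card (B' \<inter> B)" and "q' = card (B' \<inter> A)"
  note part = avoiding_partition[OF P P' x span vAB v', folded p_def q_def p'_def q'_def]
  note count = edge_count_over_biclique[OF P P' x, folded p_def q_def p'_def q'_def]
  have deg': "card S + 1 \<le> card (N x)" if "S \<subseteq> N x" "v \<notin> S" for S
  proof -
    have "finite S" using that finite_N finite_subset by blast
    then have "card S + 1 = card (insert v S)" using that by simp
    also have "\<dots> \<le> card (N x)"
      using that v by (intro card_mono finite_N) auto
    finally show ?thesis .
  qed
  show ?thesis
  proof (cases "x \<in> A'")
    case True
    then have "x \<notin> B'" using d by auto
    with True part v vB have eqs: "p + p' + 1 = s" "q' = p'" "p' + q = t"
      by auto
    have deg1: "t + 1 \<le> card (N x)"
      using deg'[OF N_left[OF P' True]] v' d by simp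
    \<comment> \<open>Otherwise \<open>B'\<close> equals \<open>B\<close>, and \<open>x\<close> would be joined to all of it.\<close>
    have "p' \<noteq> 0"
    proof
      assume "p' = 0"
      then have "card (B' \<inter> B) = card B" using eqs d by (simp add: q_def)
      then have "B' \<inter> B = B" using d by (intro card_subset_eq) auto
      then show False using notB N_left[OF P' True] by auto
    qed
    then have "p \<le> p' * p" "p' \<le> p' * q"
      using eqs s_le_t by (cases p'; cases q; simp)+
    moreover have "p' * p = p * q'"
      using eqs by simp
    ultimately have "s \<le> p * q' + p' * q + 1"
      using eqs by linarith
    then show ?thesis
      using count deg1 by linarith
  next
    case False
    then have xB': "x \<in> B'" using part(1) by simp
    with False part v vB have eqs: "p + q' + 1 = s" "p' = q' + 1" "p' + q = t"
      by auto
    have deg1: "s + 1 \<le> card (N x)"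
      using deg'[OF N_right[OF P' xB']] v' d by simp
    show ?thesis
    proof (cases "s = t")
      case True
      \<comment> \<open>Otherwise \<open>A'\<close> equals \<open>B\<close>, and again \<open>x\<close> would be joined to all of it.\<close>
      have "p \<noteq> 0"
      proof
        assume "p = 0"
        then have "card (A' \<inter> B) = card B" using eqs d True by (simp add: p'_def)
        then have "A' \<inter> B = B" using d by (intro card_subset_eq) auto
        then show False using notB N_right[OF P' xB'] by auto
      qed
      then have "q' \<le> p * q'" "p \<le> p * p'"
        using eqs by (cases p; simp)+
      moreover have "p' * q = p * p'" using eqs True by auto
      ultimately have "s \<le> p * q' + p' * q + 1"
        using eqs by linarith
      then show ?thesis
        using count deg1 True by linarith
    next
      case False
      then have "p + 1 \<le> q" using eqs s_le_t by linarith
      then have "(q' + 1) * (p + 1) \<le> p' * q"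
        using eqs by (intro mult_le_mono) auto
      then have "s \<le> p' * q"
        using eqs by (simp add: algebra_simps)
      then show ?thesis
        using count deg by linarith
    qed
  qed
qed

section \<open>The case of two vertices outside a biclique\<close>

text \<open>The biclique and the two stars overlap at most in the edge \<open>{a, b}\<close>, so they have at least
\<open>s t + t + s - 1\<close> edges, and the bound on \<open>E\<close> leaves no slack at all.\<close>

lemma two_outside:
  assumes small: "card E < s * t + s + t" and P: "(A, B) \<in> P"
    and ab: "a \<noteq> b" "a \<notin> A \<union> B" "b \<notin> A \<union> B"
    and deg: "t \<le> card (N a)" "s \<le> card (N b)"
  shows "{a, b} \<in> E" "card (N a) = t" "card (N b) = s" "E = bip A B \<union> star a \<union> star b"
proof -
  have fin: "finite (bip A B)"
    using finite_bip finite_sides[OF P] by blast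
  have sub: "bip A B \<union> (star a \<union> star b) \<subseteq> E"
    using bip_subset_E[OF P] by (auto simp: star_def)
  have "bip A B \<inter> (star a \<union> star b) = {}"
    using ab by (auto simp: star_def elim!: bipE)
  then have 1: "card (bip A B \<union> (star a \<union> star b)) = s * t + card (star a \<union> star b)"
    using fin finite_star sides[OF P] by (simp add: card_Un_disjoint card_bip)
  have 2: "card (star a \<union> star b) + card ({{a, b}} \<inter> E) = card (N a) + card (N b)"
    using card_Un_Int[OF finite_star[of a] finite_star[of b]] star_Int[OF ab(1)]
    by (simp add: card_star)
  have 3: "card (bip A B \<union> (star a \<union> star b)) \<le> card E"
    using sub finite_E by (rule card_mono[rotated])
  have 4: "card ({{a, b}} \<inter> E) = (if {a, b} \<in> E then 1 else 0)"
    by simp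
  show e: "{a, b} \<in> E" and "card (N a) = t" "card (N b) = s"
    using 1 2 3 4 small deg by (auto split: if_splits)
  have "card (bip A B \<union> (star a \<union> star b)) = card E"
    using 1 2 3 4 small deg e by simp
  then show "E = bip A B \<union> star a \<union> star b"
    using card_subset_eq[OF finite_E sub] by auto
qed

lemma no_triangle_in_bip:
  assumes "A \<inter> B = {}" "{a, b} \<in> bip A B" "{b, c} \<in> bip A B" "{a, c} \<in> bip A B"
  shows False
  using assms by (auto simp: doubleton_in_bip)

text \<open>In a counterexample \<open>two_outside\<close> applies to every vertex of degree at least \<open>t\<close>, once for each
outside vertex, by \<open>apex_bound\<close>. It is used twice: for \<open>a\<close> with a copy \<open>(A, B)\<close>, and for a vertex
\<open>a'\<close> of \<open>A\<close> with a copy \<open>(A', B')\<close>. By the second application every edge that misses \<open>a'\<close> and its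
partner \<open>b'\<close> lies in the bipartite graph on \<open>(A', B')\<close>; by the first, \<open>a\<close>, \<open>b\<close> and some \<open>c\<close> form a
triangle of such edges.\<close>

theorem card_E_ge: "s * t + s + t \<le> card E"
proof (rule ccontr)
  assume "\<not> s * t + s + t \<le> card E"
  then have small: "card E < s * t + s + t" by simp
  have outside: "\<exists>b. b \<in> \<Union>E \<and> b \<noteq> a \<and> b \<notin> A \<union> B"
    if "(A, B) \<in> P" "a \<notin> A \<union> B" "t \<le> card (N a)" for A B a
    using apex_bound[OF that(1,2) _ that(3)] small by auto
  have deg_t: "card (N a) = t" if a_deg: "t \<le> card (N a)" for a
  proof -
    obtain A B where P: "(A, B) \<in> P" and a: "a \<notin> A \<union> B"
      using avoid by blast
    obtain b where "b \<in> \<Union>E" "b \<noteq> a" "b \<notin> A \<union> B"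
      using outside[OF P a a_deg] by blast
    then show ?thesis
      using two_outside(2)[OF small P _ a _ a_deg min_degree] by metis
  qed
  obtain A0 B0 a where "(A0, B0) \<in> P" "a \<in> A0"
    using avoid sides s_ge_2 by (metis card.empty equals0I not_numeral_le_zero)
  then have deg_a: "t \<le> card (N a)"
    by (rule degree_left)
  obtain A B where P: "(A, B) \<in> P" and a: "a \<notin> A \<union> B"
    using avoid by blast
  note d = sides[OF P] finite_sides[OF P]
  obtain b where b: "b \<in> \<Union>E" "b \<noteq> a" "b \<notin> A \<union> B"
    using outside[OF P a deg_a] by blast
  note ab = two_outside[OF small P b(2)[symmetric] a b(3) deg_a min_degree[OF b(1)]]
  obtain a' where a': "a' \<in> A"
    using d s_ge_2 by (metis card.empty equals0I not_numeral_le_zero)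
  \<comment> \<open>Degrees above \<open>t\<close> do not occur, so vertices of \<open>A\<close> have no neighbours beyond \<open>B\<close>.\<close>
  have N_A: "N w = B" if "w \<in> A" for w
    using N_left[OF P that] deg_t[OF degree_left[OF P that]] d finite_N
    by (metis card_subset_eq)
  obtain A' B' where P': "(A', B') \<in> P" and a'_out: "a' \<notin> A' \<union> B'"
    using avoid by blast
  have deg_a': "t \<le> card (N a')"
    by (rule degree_left[OF P a'])
  obtain b' where b': "b' \<in> \<Union>E" "b' \<noteq> a'" "b' \<notin> A' \<union> B'"
    using outside[OF P' a'_out deg_a'] by blast
  note ab' = two_outside[OF small P' b'(2)[symmetric] a'_out b'(3) deg_a' min_degree[OF b'(1)]]
  have b'_B: "b' \<in> B"
    using ab'(1) N_A[OF a'] by (auto simp: N_def)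
  have N_b': "N b' = A"
    using N_right[OF P b'_B] ab'(3) d finite_N by (metis card_subset_eq)
  have "card (N b - {a}) > 0"
    using ab(3) s_ge_2 finite_N by (simp add: card_Diff_singleton_if)
  then obtain c where c: "c \<in> N b" "c \<noteq> a"
    by (metis Diff_iff card_gt_0_iff equals0I insertI1)
  have c_V: "c \<in> \<Union>E" and cb: "c \<noteq> b"
    using c N_subset_Union_E N_irrefl by blast+
  have cA: "c \<notin> A"
    using N_A[of c] c(1) N_sym[of b c] b(3) by auto
  have c_b': "c \<noteq> b'"
    using N_b' c(1) N_sym[of b c] b(3) by auto
  have ac: "{a, c} \<in> E"
  proof (cases "c \<in> B")
    case False
    then show ?thesis
      using two_outside(1)[OF small P c(2)[symmetric] a _ deg_a min_degree[OF c_V]] cA by simp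
  next
    case True
    \<comment> \<open>With a second outside vertex \<open>z\<close>, \<open>two_outside\<close> would leave no room for the edge \<open>{b, c}\<close>.\<close>
    have only_b: "z \<in> A \<union> B \<union> {a, b}" if "z \<in> \<Union>E" for z
    proof (rule ccontr)
      assume z: "z \<notin> A \<union> B \<union> {a, b}"
      then have "E = bip A B \<union> star a \<union> star z"
        using two_outside(4)[OF small P _ a _ deg_a min_degree[OF that]] by auto
      moreover have "{b, c} \<in> E"
        using c(1) by (simp add: N_def)
      moreover have "{b, c} \<notin> bip A B"
        using b(3) by (simp add: doubleton_in_bip)
      moreover have "{b, c} \<notin> star a \<union> star z"
        using True z b(2) c(2) by (auto simp: star_def)
      ultimately show False
        by blast
    qed
    \<comment> \<open>Both sides have \<open>t - 1\<close> elements, so equality follows and \<open>c\<close> is a neighbour of \<open>a\<close>.\<close>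
    have "N a - {b} \<subseteq> B - {b'}"
    proof
      fix y assume y: "y \<in> N a - {b}"
      then have "y \<in> A \<union> B"
        using only_b[of y] N_subset_Union_E[of a] N_irrefl[of a] by blast
      moreover have "y \<notin> A"
        using N_A[of y] y N_sym[of y a] a by auto
      moreover have "y \<noteq> b'"
        using N_b' y N_sym[of y a] a by auto
      ultimately show "y \<in> B - {b'}" by auto
    qed
    moreover have "card (N a - {b}) = card (B - {b'})"
      using ab(1,2) d b'_B finite_N by (simp add: N_def)
    ultimately have "N a - {b} = B - {b'}"
      using d by (intro card_subset_eq) auto
    then show ?thesis
      using True c_b' by (auto simp: N_def)
  qed
  have in_copy: "{y, z} \<in> bip A' B'"
    if "{y, z} \<in> E" "y \<in> {a, b, c}" "z \<in> {a, b, c}" for y z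
  proof -
    have "a' \<notin> {a, b, c}" "b' \<notin> {a, b, c}"
      using a b a' b'_B cA c_b' by auto
    then have "{y, z} \<notin> star a' \<union> star b'"
      using that by (auto simp: star_def)
    then show ?thesis
      using that(1) ab'(4) by blast
  qed
  show False
    using no_triangle_in_bip[of A' B' a b c] sides[OF P'] in_copy ab(1) ac c(1)
    by (auto simp: N_def)
qed

end

section \<open>Lexicographically ordered bicliques in an arrowing host\<close>

text \<open>What is kept of the lexicographic order: the edges at one vertex of \<open>A\<close> all come before the edges
at another.\<close>

definition lex_blocks :: "'v eograph \<Rightarrow> 'v set \<Rightarrow> 'v set \<Rightarrow> bool" where
  "lex_blocks F A B \<longleftrightarrow> (\<forall>w\<in>A. \<forall>w'\<in>A. w \<noteq> w' \<longrightarrow>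
     (\<forall>u\<in>B. \<forall>u'\<in>B. ({w, u}, {w', u'}) \<in> eord F) \<or>
     (\<forall>u\<in>B. \<forall>u'\<in>B. ({w', u}, {w, u'}) \<in> eord F))"

lemma eord_asym:
  assumes "edge_ordered_graph F" "(e, f) \<in> eord F"
  shows "(f, e) \<notin> eord F"
  using assms unfolding edge_ordered_graph_def strict_linear_order_on_def
  by (meson irrefl_def transD)

text \<open>On a common \<open>K\<^sub>2\<^sub>,\<^sub>2\<close> with sides \<open>{w, w'}\<close> and \<open>{u, u'}\<close>, one copy puts the two edges at \<open>w\<close> on one side
of the two edges at \<open>w'\<close>, the other copy separates \<open>u\<close> from \<open>u'\<close>. The edges \<open>{w, u'}\<close> and \<open>{w', u}\<close>,
or else \<open>{w, u}\<close> and \<open>{w', u'}\<close>, are then ordered in both directions: each choice of the two block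
orders agrees on one of these pairs and conflicts on the other.\<close>

lemma lex_blocks_not_swapped:
  assumes F: "edge_ordered_graph F" and "lex_blocks F A B" "lex_blocks F A' B'"
  shows "card (A' \<inter> B) \<le> 1 \<or> card (B' \<inter> A) \<le> 1"
proof (rule ccontr)
  assume "\<not> ?thesis"
  then have "1 < card (A' \<inter> B)" "1 < card (B' \<inter> A)"
    by auto
  then obtain u u' w w' where u: "u \<in> A'" "u \<in> B" "u' \<in> A'" "u' \<in> B" "u \<noteq> u'"
    and w: "w \<in> B'" "w \<in> A" "w' \<in> B'" "w' \<in> A" "w \<noteq> w'"
    by (metis Int_iff One_nat_def card_le_Suc0_iff_eq card.infinite linorder_not_le not_one_less_zero)
  have "({w, u}, {w', u'}) \<in> eord F \<and> ({w, u'}, {w', u}) \<in> eord F \<or>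
      ({w', u}, {w, u'}) \<in> eord F \<and> ({w', u'}, {w, u}) \<in> eord F"
    using assms(2) u w unfolding lex_blocks_def by blast
  moreover have "({u, w}, {u', w'}) \<in> eord F \<and> ({u, w'}, {u', w}) \<in> eord F \<or>
      ({u', w}, {u, w'}) \<in> eord F \<and> ({u', w'}, {u, w}) \<in> eord F"
    using assms(3) u w unfolding lex_blocks_def by blast
  ultimately show False
    using eord_asym[OF F]
    unfolding insert_commute[of u w] insert_commute[of u w'] insert_commute[of u' w]
      insert_commute[of u' w'] by blast
qed

lemma edge_of_complete_bipartite_lex:
  "{Inl i, Inr j} \<in> edges (complete_bipartite_lex s t) \<longleftrightarrow> i \<in> {1..s} \<and> j \<in> {1..t}"
  by (auto simp: complete_bipartite_lex_def doubleton_eq_iff)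

lemma eord_of_complete_bipartite_lex:
  "({Inl i, Inr j}, {Inl k, Inr l}) \<in> eord (complete_bipartite_lex s t) \<longleftrightarrow>
    i \<in> {1..s} \<and> j \<in> {1..t} \<and> k \<in> {1..s} \<and> l \<in> {1..t} \<and> (i < k \<or> i = k \<and> j < l)"
proof
  assume "({Inl i, Inr j}, {Inl k, Inr l}) \<in> eord (complete_bipartite_lex s t)"
  then show "i \<in> {1..s} \<and> j \<in> {1..t} \<and> k \<in> {1..s} \<and> l \<in> {1..t} \<and> (i < k \<or> i = k \<and> j < l)"
    by (auto simp: complete_bipartite_lex_def doubleton_eq_iff)
qed (auto simp: complete_bipartite_lex_def)

lemma eo_copy_complete_bipartite_lexE:
  assumes "eo_copy C (complete_bipartite_lex s t) F"
  obtains A B where "A \<inter> B = {}" "card A = s" "card B = t" "bip A B \<subseteq> edges C" "lex_blocks F A B"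
proof -
  let ?K = "complete_bipartite_lex s t"
  obtain \<phi> where bij: "bij_betw \<phi> (verts C) (verts ?K)"
    and edge: "\<And>x y. x \<in> verts C \<Longrightarrow> y \<in> verts C \<Longrightarrow> {x, y} \<in> edges C \<longleftrightarrow> {\<phi> x, \<phi> y} \<in> edges ?K"
    and ord: "\<And>e f. e \<in> edges C \<Longrightarrow> f \<in> edges C \<Longrightarrow> (e, f) \<in> eord C \<longleftrightarrow> (\<phi> ` e, \<phi> ` f) \<in> eord ?K"
    using assms unfolding eo_copy_def eo_isomorphic_def by metis
  have sub: "eord C \<subseteq> eord F"
    using assms by (auto simp: eo_copy_def eo_subgraph_def)
  define u where "u i = inv_into (verts C) \<phi> (Inl i)" for i
  define v where "v j = inv_into (verts C) \<phi> (Inr j)" for j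
  have vertsK: "verts ?K = Inl ` {1..s} \<union> Inr ` {1..t}"
    by (simp add: complete_bipartite_lex_def)
  have u: "u i \<in> verts C" "\<phi> (u i) = Inl i" if "i \<in> {1..s}" for i
    using that bij vertsK unfolding u_def
    by (metis (no_types, lifting) UnI1 bij_betw_imp_surj_on imageI inv_into_into,
        metis (no_types, lifting) UnI1 bij_betw_inv_into_right imageI)
  have v: "v j \<in> verts C" "\<phi> (v j) = Inr j" if "j \<in> {1..t}" for j
    using that bij vertsK unfolding v_def
    by (metis (no_types, lifting) UnI2 bij_betw_imp_surj_on imageI inv_into_into,
        metis (no_types, lifting) UnI2 bij_betw_inv_into_right imageI)
  have edgeC: "{u i, v j} \<in> edges C" if "i \<in> {1..s}" "j \<in> {1..t}" for i j
    using that edge[of "u i" "v j"] u v by (simp add: edge_of_complete_bipartite_lex)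
  have ordF: "({u i, v j}, {u k, v l}) \<in> eord F"
    if "i \<in> {1..s}" "j \<in> {1..t}" "k \<in> {1..s}" "l \<in> {1..t}" "i < k" for i j k l
    using that ord[of "{u i, v j}" "{u k, v l}"] edgeC u v sub
    by (auto simp: eord_of_complete_bipartite_lex)
  show thesis
  proof
    show "u ` {1..s} \<inter> v ` {1..t} = {}"
      using u v by (auto, metis Inl_Inr_False atLeastAtMost_iff One_nat_def)
    show "card (u ` {1..s}) = s"
      using u(2) by (subst card_image) (auto simp: inj_on_def, metis atLeastAtMost_iff One_nat_def sum.inject(1))
    show "card (v ` {1..t}) = t"
      using v(2) by (subst card_image) (auto simp: inj_on_def, metis atLeastAtMost_iff One_nat_def sum.inject(2))
    show "bip (u ` {1..s}) (v ` {1..t}) \<subseteq> edges C"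
      using edgeC by (auto elim!: bipE)
    have "(\<forall>x\<in>v ` {1..t}. \<forall>y\<in>v ` {1..t}. ({u i, x}, {u k, y}) \<in> eord F) \<or>
        (\<forall>x\<in>v ` {1..t}. \<forall>y\<in>v ` {1..t}. ({u k, x}, {u i, y}) \<in> eord F)"
      if "i \<in> {1..s}" "k \<in> {1..s}" "u i \<noteq> u k" for i k
    proof -
      have "i < k \<or> k < i" using that by (metis linorder_neqE_nat)
      then show ?thesis using ordF that by blast
    qed
    then show "lex_blocks F (u ` {1..s}) (v ` {1..t})"
      unfolding lex_blocks_def by blast
  qed
qed

lemma eo_copy_2K2_disjoint_edges:
  assumes M: "is_2K2 M" and C: "eo_copy C M F"
  obtains e f where "e \<in> edges C" "f \<in> edges C" "e \<inter> f = {}"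
proof -
  obtain \<phi> where bij: "bij_betw \<phi> (verts C) (verts M)"
    and edge: "\<And>x y. x \<in> verts C \<Longrightarrow> y \<in> verts C \<Longrightarrow> {x, y} \<in> edges C \<longleftrightarrow> {\<phi> x, \<phi> y} \<in> edges M"
    using C unfolding eo_copy_def eo_isomorphic_def by metis
  obtain e f where ef: "e \<in> edges M" "f \<in> edges M" "e \<inter> f = {}"
    using M unfolding is_2K2_def by (metis card_2_iff insertI1 insert_commute)
  have pull: "inv_into (verts C) \<phi> ` g \<in> edges C" and sub: "g \<subseteq> verts M"
    if g: "g \<in> edges M" for g
  proof -
    have "g \<subseteq> verts M \<and> card g = 2"
      using M g by (auto simp: is_2K2_def edge_ordered_graph_def)
    then obtain x y where xy: "g = {x, y}" "x \<in> verts M" "y \<in> verts M"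
      by (auto simp: card_2_iff)
    show "g \<subseteq> verts M" using xy by simp
    have "inv_into (verts C) \<phi> z \<in> verts C \<and> \<phi> (inv_into (verts C) \<phi> z) = z" if "z \<in> verts M" for z
      using bij that by (metis bij_betw_def f_inv_into_f inv_into_into)
    then show "inv_into (verts C) \<phi> ` g \<in> edges C"
      using edge xy g by simp
  qed
  have "inj_on (inv_into (verts C) \<phi>) (verts M)"
    using bij by (metis bij_betw_def bij_betw_inv_into)
  then have "inv_into (verts C) \<phi> ` e \<inter> inv_into (verts C) \<phi> ` f = {}"
    using ef sub by (metis image_empty inj_on_image_Int)
  then show thesis
    using that pull ef by blast
qed

text \<open>Colour the edges at \<open>x\<close> red. They meet pairwise, so the arrowing yields a blue biclique, and since
each of its vertices lies on one of its edges, \<open>x\<close> is not among them.\<close>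

lemma eo_arrows_2K2_biclique_avoiding:
  assumes M: "is_2K2 M" and F: "eo_arrows F M (complete_bipartite_lex s t)" and st: "0 < s" "0 < t"
  obtains A B where "A \<inter> B = {}" "card A = s" "card B = t" "bip A B \<subseteq> edges F" "lex_blocks F A B"
    "x \<notin> A \<union> B"
proof -
  let ?c = "\<lambda>e. if x \<in> e then Red else Blue"
  have no_red: "\<not> (\<exists>C. eo_copy C M F \<and> (\<forall>e\<in>edges C. ?c e = Red))"
    by (metis (full_types) M IntI colour.distinct(1) empty_iff eo_copy_2K2_disjoint_edges)
  then obtain C where C: "eo_copy C (complete_bipartite_lex s t) F" and "\<forall>e\<in>edges C. ?c e = Blue"
    using spec[OF F[unfolded eo_arrows_def], of ?c] by blast
  then have x: "\<forall>e\<in>edges C. x \<notin> e"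
    by (metis colour.distinct(1))
  obtain A B where AB: "A \<inter> B = {}" "card A = s" "card B = t" "bip A B \<subseteq> edges C" "lex_blocks F A B"
    using eo_copy_complete_bipartite_lexE[OF C] by blast
  obtain a b where "a \<in> A" "b \<in> B"
    using AB st by (metis card.empty equals0I less_irrefl)
  then have "x \<notin> A \<union> B"
    using x AB(4) by (blast intro: bipI)
  moreover have "edges C \<subseteq> edges F"
    using C by (simp add: eo_copy_def eo_subgraph_def)
  ultimately show thesis
    using that AB by blast
qed

lemma card_edges_arrowing_ge:
  fixes F :: "'v eograph"
  assumes st: "2 \<le> s" "s \<le> t" and M: "is_2K2 M" and F: "edge_ordered_graph F"
    and arrows: "eo_arrows F M (complete_bipartite_lex s t)"
  shows "s * t + s + t \<le> card (edges F)"
proof -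
  define P where "P = {(A, B). A \<inter> B = {} \<and> card A = s \<and> card B = t \<and> bip A B \<subseteq> edges F \<and>
    lex_blocks F A B}"
  have "edges F \<subseteq> Pow (verts F)" "finite (verts F)"
    using F by (auto simp: edge_ordered_graph_def)
  then have fin: "finite (edges F)"
    by (meson finite_Pow_iff finite_subset)
  have sub: "(\<Union>(A, B)\<in>P. bip A B) \<subseteq> edges F"
    by (auto simp: P_def)
  interpret unstabbed_bicliques P s t
  proof
    fix v
    show "\<exists>A B. (A, B) \<in> P \<and> v \<notin> A \<union> B"
      using st unfolding P_def
      by (rule_tac eo_arrows_2K2_biclique_avoiding[OF M arrows, of v]) auto
  next
    fix A B A' B'
    assume "(A, B) \<in> P" "(A', B') \<in> P"
    then show "card (A' \<inter> B) \<le> 1 \<or> card (B' \<inter> A) \<le> 1"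
      using lex_blocks_not_swapped[OF F] by (auto simp: P_def)
  next
    show "finite (\<Union>(A, B)\<in>P. bip A B)"
      using sub fin by (rule finite_subset)
  qed (use st in \<open>auto simp: P_def\<close>)
  have "card E \<le> card (edges F)"
    unfolding E_def using sub fin by (rule card_mono[rotated])
  then show ?thesis
    using card_E_ge by simp
qed

section \<open>Transporting edge-ordered graphs along injections\<close>

definition map_eo :: "('v \<Rightarrow> 'w) \<Rightarrow> 'v eograph \<Rightarrow> 'w eograph" where
  "map_eo g G = \<lparr>verts = g ` verts G, edges = (`) g ` edges G,
     eord = map_prod ((`) g) ((`) g) ` eord G\<rparr>"

lemma image_in_image_edges: "inj g \<Longrightarrow> g ` e \<in> (`) g ` S \<longleftrightarrow> e \<in> S"
  by (auto simp: inj_image_eq_iff)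

lemma image_pair_in_eord:
  "inj g \<Longrightarrow> (g ` e, g ` f) \<in> eord (map_eo g G) \<longleftrightarrow> (e, f) \<in> eord G"
  by (force simp: map_eo_def inj_image_eq_iff image_iff)

lemma edge_ordered_graph_map_eo:
  assumes g: "inj g" and G: "edge_ordered_graph G"
  shows "edge_ordered_graph (map_eo g G)"
proof -
  have lin: "trans (eord G)" "irrefl (eord G)" "total_on (edges G) (eord G)"
    and sub: "eord G \<subseteq> edges G \<times> edges G"
    using G by (auto simp: edge_ordered_graph_def strict_linear_order_on_def)
  have "trans (eord (map_eo g G))"
  proof (rule transI)
    fix x y z
    assume xy: "(x, y) \<in> eord (map_eo g G)" and yz: "(y, z) \<in> eord (map_eo g G)"
    from xy obtain a b where ab: "x = g ` a" "y = g ` b" "(a, b) \<in> eord G"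
      by (auto simp: map_eo_def)
    from yz obtain b' c where bc: "y = g ` b'" "z = g ` c" "(b', c) \<in> eord G"
      by (auto simp: map_eo_def)
    have "b = b'"
      using ab(2) bc(1) g by (simp add: inj_image_eq_iff)
    then have "(a, c) \<in> eord G"
      using ab(3) bc(3) lin(1) by (blast dest: transD)
    then show "(x, z) \<in> eord (map_eo g G)"
      using ab bc g by (simp add: image_pair_in_eord)
  qed
  moreover have "irrefl (eord (map_eo g G))"
    using lin(2) g by (auto simp: irrefl_def map_eo_def inj_image_eq_iff)
  moreover have "total_on (edges (map_eo g G)) (eord (map_eo g G))"
  proof (rule total_onI)
    fix x y
    assume "x \<in> edges (map_eo g G)" "y \<in> edges (map_eo g G)" "x \<noteq> y"
    then obtain a b where "x = g ` a" "y = g ` b" "a \<in> edges G" "b \<in> edges G" "a \<noteq> b"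
      by (auto simp: map_eo_def)
    then show "(x, y) \<in> eord (map_eo g G) \<or> (y, x) \<in> eord (map_eo g G)"
      using lin(3) g by (simp add: image_pair_in_eord total_on_def)
  qed
  moreover have "card (g ` e) = card e" for e
    using g by (simp add: card_image inj_on_subset)
  moreover have "g ` e \<subseteq> g ` verts G" if "e \<in> edges G" for e
    using G that by (intro image_mono) (simp add: edge_ordered_graph_def)
  ultimately show ?thesis
    using G sub unfolding edge_ordered_graph_def strict_linear_order_on_def
    by (auto simp: map_eo_def)
qed

lemma eo_isomorphic_map_eo:
  assumes g: "inj g"
  shows "eo_isomorphic (map_eo g G) G"
  unfolding eo_isomorphic_def
proof (intro exI[of _ "inv g"] conjI ballI)
  show "bij_betw (inv g) (verts (map_eo g G)) (verts G)"
    using g by (auto simp: bij_betw_def map_eo_def inj_on_def image_image)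
next
  fix x y
  assume "x \<in> verts (map_eo g G)" "y \<in> verts (map_eo g G)"
  then obtain a b where "x = g a" "y = g b"
    by (auto simp: map_eo_def)
  moreover have "{g a, g b} = g ` {a, b}" by simp
  ultimately show "{x, y} \<in> edges (map_eo g G) \<longleftrightarrow> {inv g x, inv g y} \<in> edges G"
    using g image_in_image_edges[OF g, of "{a, b}" "edges G"] by (simp add: map_eo_def)
next
  fix e f
  assume "e \<in> edges (map_eo g G)" "f \<in> edges (map_eo g G)"
  then obtain a b where "e = g ` a" "f = g ` b"
    by (auto simp: map_eo_def)
  then show "(e, f) \<in> eord (map_eo g G) \<longleftrightarrow> (inv g ` e, inv g ` f) \<in> eord G"
    using g by (simp add: image_pair_in_eord image_inv_f_f)
qed

lemma map_eo_comp: "map_eo g (map_eo h G) = map_eo (g \<circ> h) G"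
  by (auto simp: map_eo_def image_image image_comp map_prod_def case_prod_beta)

text \<open>Inclusion of the orders suffices, because a linear order on \<open>edges C\<close> admits no proper extension to
a strict order on the same set.\<close>

lemma eo_subgraphI:
  assumes C: "edge_ordered_graph C" and F: "edge_ordered_graph F"
    and sub: "verts C \<subseteq> verts F" "edges C \<subseteq> edges F" "eord C \<subseteq> eord F"
  shows "eo_subgraph C F"
  unfolding eo_subgraph_def
proof (intro conjI sub equalityI subsetI)
  fix p assume "p \<in> eord C"
  then show "p \<in> eord F \<inter> edges C \<times> edges C"
    using C sub by (auto simp: edge_ordered_graph_def)
next
  fix p assume p: "p \<in> eord F \<inter> edges C \<times> edges C"
  then obtain e f where ef: "p = (e, f)" "(e, f) \<in> eord F" "e \<in> edges C" "f \<in> edges C"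
    by auto
  have "(f, e) \<notin> eord F" using eord_asym[OF F ef(2)] .
  moreover have "e \<noteq> f" using ef(2) eord_asym[OF F ef(2)] by auto
  moreover have "total_on (edges C) (eord C)"
    using C by (simp add: edge_ordered_graph_def strict_linear_order_on_def)
  ultimately show "p \<in> eord C"
    using ef sub(3) by (metis subsetD total_on_def)
qed

section \<open>Edge-ordered matchings with two edges\<close>

definition matching_eo :: "'v \<Rightarrow> 'v \<Rightarrow> 'v \<Rightarrow> 'v \<Rightarrow> 'v eograph" where
  "matching_eo a b c d =
     \<lparr>verts = {a, b, c, d}, edges = {{a, b}, {c, d}}, eord = {({a, b}, {c, d})}\<rparr>"

lemma is_2K2_matching_eo:
  assumes "distinct [a, b, c, d]"
  shows "is_2K2 (matching_eo a b c d)"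
proof -
  have "{a, b} \<noteq> {c, d}"
    using assms by (simp add: doubleton_eq_iff)
  then show ?thesis
    using assms unfolding is_2K2_def edge_ordered_graph_def strict_linear_order_on_def matching_eo_def
    by (auto simp: trans_def irrefl_def total_on_def)
qed

text \<open>Naming the smaller edge \<open>{a, b}\<close> gives a normal form, so any two ordered matchings with two edges
are isomorphic.\<close>

lemma is_2K2E:
  assumes M: "is_2K2 M"
  obtains a b c d where "distinct [a, b, c, d]" "M = matching_eo a b c d"
proof -
  have G: "edge_ordered_graph M"
    using M by (simp add: is_2K2_def)
  obtain e' f' where ef': "edges M = {e', f'}" "e' \<noteq> f'"
    using M by (auto simp: is_2K2_def card_2_iff)
  have tot: "total_on (edges M) (eord M)" "eord M \<subseteq> edges M \<times> edges M"
    using G by (auto simp: edge_ordered_graph_def strict_linear_order_on_def)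
  then have "(e', f') \<in> eord M \<or> (f', e') \<in> eord M"
    using ef' by (auto simp: total_on_def)
  then obtain e f where ef: "edges M = {e, f}" "e \<noteq> f" "(e, f) \<in> eord M"
    using ef' by (metis insert_commute)
  have "(e, e) \<notin> eord M" "(f, f) \<notin> eord M" "(f, e) \<notin> eord M"
    using eord_asym[OF G] ef(3) by blast+
  then have ord: "eord M = {(e, f)}"
    using tot(2) ef by auto
  have "card e = 2" "card f = 2"
    using G ef(1) by (auto simp: edge_ordered_graph_def)
  then obtain a b c d where abcd: "e = {a, b}" "a \<noteq> b" "f = {c, d}" "c \<noteq> d"
    by (metis card_2_iff)
  have "e \<inter> f = {}" "verts M = e \<union> f"
    using M ef by (auto simp: is_2K2_def)
  then have "verts M = {a, b, c, d}" and "distinct [a, b, c, d]"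
    unfolding abcd using abcd(2,4) by auto
  moreover have "M = matching_eo a b c d"
    using calculation(1) ef(1) ord abcd by (cases M) (simp add: matching_eo_def)
  ultimately show thesis by (intro that)
qed

lemma eo_isomorphic_2K2:
  assumes "is_2K2 C" "is_2K2 M"
  shows "eo_isomorphic C M"
proof -
  obtain a b c d where C: "distinct [a, b, c, d]" "C = matching_eo a b c d"
    using assms(1) by (rule is_2K2E)
  obtain a' b' c' d' where M: "distinct [a', b', c', d']" "M = matching_eo a' b' c' d'"
    using assms(2) by (rule is_2K2E)
  define \<phi> where "\<phi> x = (if x = a then a' else if x = b then b' else if x = c then c' else d')" for x
  have \<phi>: "\<phi> a = a'" "\<phi> b = b'" "\<phi> c = c'" "\<phi> d = d'"
    using C(1) by (auto simp: \<phi>_def)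
  have ne: "{a, b} \<noteq> {c, d}" "{c, d} \<noteq> {a, b}" "{a', b'} \<noteq> {c', d'}" "{c', d'} \<noteq> {a', b'}"
    using C(1) M(1) by (auto simp: doubleton_eq_iff)
  show ?thesis
    unfolding eo_isomorphic_def
  proof (intro exI[of _ \<phi>] conjI ballI)
    have "inj_on \<phi> {a, b, c, d}"
      using C(1) M(1) by (auto simp: inj_on_def \<phi>)
    then show "bij_betw \<phi> (verts C) (verts M)"
      using C(2) M(2) by (simp add: bij_betw_def matching_eo_def \<phi>)
  next
    fix x y assume "x \<in> verts C" "y \<in> verts C"
    then have "x = a \<or> x = b \<or> x = c \<or> x = d" "y = a \<or> y = b \<or> y = c \<or> y = d"
      using C(2) by (simp_all add: matching_eo_def)
    then show "{x, y} \<in> edges C \<longleftrightarrow> {\<phi> x, \<phi> y} \<in> edges M"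
      using C(1) M(1) unfolding C(2) M(2)
      by (elim disjE; auto simp: matching_eo_def doubleton_eq_iff \<phi>)
  next
    fix e f assume "e \<in> edges C" "f \<in> edges C"
    then have "e = {a, b} \<or> e = {c, d}" "f = {a, b} \<or> f = {c, d}"
      using C(2) by (simp_all add: matching_eo_def)
    then show "(e, f) \<in> eord C \<longleftrightarrow> (\<phi> ` e, \<phi> ` f) \<in> eord M"
      unfolding C(2) M(2) by (elim disjE; simp add: matching_eo_def \<phi> ne)
  qed
qed

lemma disjoint_edges_eo_copy_2K2:
  assumes F: "edge_ordered_graph F" and M: "is_2K2 M"
    and ef: "e \<in> edges F" "f \<in> edges F" "e \<inter> f = {}"
  obtains C where "eo_copy C M F" "edges C = {e, f}"
proof -
  have wlog: "\<exists>C. eo_copy C M F \<and> edges C = {e, f}"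
    if ef: "e \<in> edges F" "f \<in> edges F" "e \<inter> f = {}" "(e, f) \<in> eord F" for e f
  proof -
    have e2: "e \<subseteq> verts F" "card e = 2" "f \<subseteq> verts F" "card f = 2"
      using F ef by (auto simp: edge_ordered_graph_def)
    then obtain a b c d where abcd: "e = {a, b}" "a \<noteq> b" "f = {c, d}" "c \<noteq> d"
      by (metis card_2_iff)
    let ?C = "matching_eo a b c d"
    have "distinct [a, b, c, d]"
      using abcd ef(3) by auto
    then have C: "is_2K2 ?C"
      by (rule is_2K2_matching_eo)
    have "eo_subgraph ?C F"
      using C F abcd ef e2 by (intro eo_subgraphI) (auto simp: is_2K2_def matching_eo_def)
    then have "eo_copy ?C M F"
      using C eo_isomorphic_2K2[OF C M] by (simp add: eo_copy_def is_2K2_def)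
    then show ?thesis
      using abcd by (auto simp: matching_eo_def)
  qed
  have "e \<noteq> f"
    using ef F by (force simp: edge_ordered_graph_def)
  then have "(e, f) \<in> eord F \<or> (f, e) \<in> eord F"
    using F ef by (auto simp: edge_ordered_graph_def strict_linear_order_on_def total_on_def)
  then show thesis
    using wlog[of e f] wlog[of f e] ef that
    unfolding Int_commute[of f e] insert_commute[of f e] by blast
qed

section \<open>An optimal host\<close>

definition punctured_biclique :: "nat \<Rightarrow> nat \<Rightarrow> (nat + nat) eograph" where
  "punctured_biclique s t = (let K = complete_bipartite_lex (s + 1) (t + 1);
       D = edges K - {{Inl (s + 1), Inr (t + 1)}}
     in \<lparr>verts = verts K, edges = D, eord = eord K \<inter> D \<times> D\<rparr>)"

lemma edge_ordered_graph_restrict: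
  assumes G: "edge_ordered_graph G" and D: "D \<subseteq> edges G"
  shows "edge_ordered_graph \<lparr>verts = verts G, edges = D, eord = eord G \<inter> D \<times> D\<rparr>"
proof -
  have lin: "trans (eord G)" "irrefl (eord G)" "total_on (edges G) (eord G)"
    using G by (auto simp: edge_ordered_graph_def strict_linear_order_on_def)
  have "trans (eord G \<inter> D \<times> D)"
    using lin(1) by (rule trans_Restr)
  moreover have "irrefl (eord G \<inter> D \<times> D)"
    using lin(2) by (auto simp: irrefl_def)
  moreover have "total_on D (eord G \<inter> D \<times> D)"
    using lin(3) D by (auto simp: total_on_def)
  ultimately show ?thesis
    using G D by (auto simp: edge_ordered_graph_def strict_linear_order_on_def)
qed

lemma edge_ordered_graph_punctured_biclique: "edge_ordered_graph (punctured_biclique s t)"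
  unfolding punctured_biclique_def Let_def
  by (intro edge_ordered_graph_restrict edge_ordered_graph_complete_bipartite_lex) auto

lemma edge_of_punctured_biclique:
  "{Inl i, Inr j} \<in> edges (punctured_biclique s t) \<longleftrightarrow>
    i \<in> {1..s + 1} \<and> j \<in> {1..t + 1} \<and> (i, j) \<noteq> (s + 1, t + 1)"
  using edge_of_complete_bipartite_lex[of i j "s + 1" "t + 1"]
  by (auto simp: punctured_biclique_def Let_def doubleton_eq_iff)

lemma card_edges_punctured_biclique: "card (edges (punctured_biclique s t)) = s * t + s + t"
proof -
  have "edges (complete_bipartite_lex (s + 1) (t + 1)) =
      bip (Inl ` {1..s + 1}) (Inr ` {1..t + 1})"
  proof
    show "edges (complete_bipartite_lex (s + 1) (t + 1)) \<subseteq>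
        bip (Inl ` {1..s + 1}) (Inr ` {1..t + 1})"
      by (auto simp: complete_bipartite_lex_def intro!: bipI)
    show "bip (Inl ` {1..s + 1}) (Inr ` {1..t + 1}) \<subseteq>
        edges (complete_bipartite_lex (s + 1) (t + 1))"
      by (auto simp del: One_nat_def simp: edge_of_complete_bipartite_lex elim!: bipE)
  qed
  moreover have "card (bip (Inl ` {1..s + 1}) (Inr ` {1..t + 1} :: (nat + nat) set))
      = (s + 1) * (t + 1)"
    by (subst card_bip) (auto simp: card_image)
  ultimately have "card (edges (complete_bipartite_lex (s + 1) (t + 1))) = (s + 1) * (t + 1)"
    by simp
  moreover have "{Inl (s + 1), Inr (t + 1)} \<in> edges (complete_bipartite_lex (s + 1) (t + 1))"
    by (simp add: edge_of_complete_bipartite_lex del: One_nat_def)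
  ultimately show ?thesis
    by (simp add: punctured_biclique_def Let_def)
qed

text \<open>The increasing enumeration of the numbers other than \<open>m\<close>. It selects the vertices that remain on
one side of a biclique when the vertex numbered \<open>m\<close> is deleted, and it preserves the lexicographic
order.\<close>

definition skip :: "nat \<Rightarrow> nat \<Rightarrow> nat" where
  "skip m k = (if k < m then k else k + 1)"

lemma inj_skip: "inj (skip m)"
  by (auto simp: inj_def skip_def split: if_splits)

lemma skip_less_iff: "skip m k < skip m l \<longleftrightarrow> k < l"
  by (auto simp: skip_def)

lemma skip_neq: "skip m k \<noteq> m"
  by (simp add: skip_def)

lemma skip_range: "k \<in> {1..s} \<Longrightarrow> skip m k \<in> {1..s + 1}"
  by (auto simp: skip_def)

text \<open>One deleted vertex is arbitrary, the other one is an end of the missing edge on the opposite side.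
Hence no edge of the embedded biclique is missing.\<close>

lemma eo_subgraph_skip:
  assumes "m = s + 1 \<or> n = t + 1"
  shows "eo_subgraph (map_eo (map_sum (skip m) (skip n)) (complete_bipartite_lex s t))
    (punctured_biclique s t)"
proof (rule eo_subgraphI)
  let ?h = "map_sum (skip m) (skip n)" and ?K = "complete_bipartite_lex s t"
  have "inj ?h"
    by (intro sum.inj_map inj_skip)
  then show "edge_ordered_graph (map_eo ?h ?K)"
    by (rule edge_ordered_graph_map_eo) (rule edge_ordered_graph_complete_bipartite_lex)
  show "edge_ordered_graph (punctured_biclique s t)"
    by (rule edge_ordered_graph_punctured_biclique)
  show "verts (map_eo ?h ?K) \<subseteq> verts (punctured_biclique s t)"
    using skip_range[of _ s m] skip_range[of _ t n]
    by (auto simp: map_eo_def complete_bipartite_lex_def punctured_biclique_def Let_def image_iff)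
  have edge: "{Inl (skip m i), Inr (skip n j)} \<in> edges (punctured_biclique s t)"
    if "i \<in> {1..s}" "j \<in> {1..t}" for i j
    using that skip_range[of i s m] skip_range[of j t n] skip_neq[of m i] skip_neq[of n j] assms
    unfolding edge_of_punctured_biclique by auto
  then show "edges (map_eo ?h ?K) \<subseteq> edges (punctured_biclique s t)"
    by (auto simp: map_eo_def complete_bipartite_lex_def)
  show "eord (map_eo ?h ?K) \<subseteq> eord (punctured_biclique s t)"
  proof
    fix p assume "p \<in> eord (map_eo ?h ?K)"
    then obtain i j k l where p: "p = ({Inl (skip m i), Inr (skip n j)}, {Inl (skip m k), Inr (skip n l)})"
      and r: "i \<in> {1..s}" "k \<in> {1..s}" "j \<in> {1..t}" "l \<in> {1..t}" "i < k \<or> i = k \<and> j < l"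
      by (auto simp: map_eo_def complete_bipartite_lex_def)
    then have "p \<in> eord (complete_bipartite_lex (s + 1) (t + 1))"
      unfolding p eord_of_complete_bipartite_lex skip_less_iff
      using skip_range[of _ s m] skip_range[of _ t n] by auto
    then show "p \<in> eord (punctured_biclique s t)"
      using edge r p by (auto simp: punctured_biclique_def Let_def)
  qed
qed

text \<open>A set of pairs, read as edges of a bipartite graph that meet pairwise, is a star.\<close>

lemma pairs_sharing_coordinate:
  assumes "\<And>i j k l. (i, j) \<in> R \<Longrightarrow> (k, l) \<in> R \<Longrightarrow> i = k \<or> j = l"
  shows "(\<exists>i. \<forall>p\<in>R. fst p = i) \<or> (\<exists>j. \<forall>p\<in>R. snd p = j)"
proof (rule ccontr)
  assume "\<not> ?thesis"
  then have 1: "\<And>i. \<exists>p\<in>R. fst p \<noteq> i" and 2: "\<And>j. \<exists>p\<in>R. snd p \<noteq> j"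
    by auto
  obtain i j where ij: "(i, j) \<in> R"
    using 1 by fastforce
  obtain k l where kl: "(k, l) \<in> R" "k \<noteq> i"
    using 1[of i] by fastforce
  obtain m n where mn: "(m, n) \<in> R" "n \<noteq> j"
    using 2[of j] by fastforce
  show False
    using assms[OF ij kl(1)] assms[OF ij mn(1)] assms[OF kl(1) mn(1)] kl mn by auto
qed

text \<open>If no two red edges are disjoint, all of them pass through one vertex. Deleting it, together with
an end of the missing edge, leaves a blue biclique.\<close>

lemma eo_arrows_punctured_biclique:
  fixes g :: "nat + nat \<Rightarrow> 'v" and M :: "'a eograph"
  assumes g: "inj g" and M: "is_2K2 M"
  shows "eo_arrows (map_eo g (punctured_biclique s t)) M (complete_bipartite_lex s t)"
  unfolding eo_arrows_def
proof
  fix c :: "'v set \<Rightarrow> colour"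
  let ?Q = "punctured_biclique s t" and ?K = "complete_bipartite_lex s t"
  let ?F = "map_eo g ?Q"
  let ?red = "\<exists>C. eo_copy C M ?F \<and> (\<forall>e\<in>edges C. c e = Red)"
  let ?blue = "\<exists>C. eo_copy C ?K ?F \<and> (\<forall>e\<in>edges C. c e = Blue)"
  have F: "edge_ordered_graph ?F"
    using g edge_ordered_graph_punctured_biclique by (rule edge_ordered_graph_map_eo)
  show "?red \<or> ?blue"
  proof (cases "\<exists>e\<in>edges ?F. \<exists>f\<in>edges ?F. e \<inter> f = {} \<and> c e = Red \<and> c f = Red")
    case True
    then obtain e f where ef: "e \<in> edges ?F" "f \<in> edges ?F" "e \<inter> f = {}" "c e = Red" "c f = Red"
      by blast
    obtain C where "eo_copy C M ?F" "edges C = {e, f}"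
      using disjoint_edges_eo_copy_2K2[OF F M ef(1-3)] .
    then have ?red using ef by (intro exI[of _ C]) auto
    then show ?thesis ..
  next
    case False
    define R where "R = {(i, j). {Inl i, Inr j} \<in> edges ?Q \<and> c (g ` {Inl i, Inr j}) = Red}"
    have "i = k \<or> j = l" if "(i, j) \<in> R" "(k, l) \<in> R" for i j k l
    proof -
      have "g ` {Inl i, Inr j} \<inter> g ` {Inl k, Inr l} \<noteq> {}"
        using that False unfolding R_def by (simp add: map_eo_def del: image_insert) blast
      then have "g ` ({Inl i, Inr j} \<inter> {Inl k, Inr l}) \<noteq> {}"
        using image_Int[OF g] by metis
      then show ?thesis by auto
    qed
    then have "(\<exists>i. \<forall>p\<in>R. fst p = i) \<or> (\<exists>j. \<forall>p\<in>R. snd p = j)"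
      by (rule pairs_sharing_coordinate)
    then have "\<exists>m n. (m = s + 1 \<or> n = t + 1) \<and> (\<forall>(i, j)\<in>R. i = m \<or> j = n)"
    proof
      assume "\<exists>i. \<forall>p\<in>R. fst p = i"
      then obtain i where "\<forall>p\<in>R. fst p = i" ..
      then show ?thesis
        by (intro exI[of _ i] exI[of _ "t + 1"]) auto
    next
      assume "\<exists>j. \<forall>p\<in>R. snd p = j"
      then obtain j where "\<forall>p\<in>R. snd p = j" ..
      then show ?thesis
        by (intro exI[of _ "s + 1"] exI[of _ j]) auto
    qed
    then obtain m n where mn: "m = s + 1 \<or> n = t + 1" and star: "\<forall>(i, j)\<in>R. i = m \<or> j = n"
      by auto
    let ?h = "map_sum (skip m) (skip n)"
    let ?C = "map_eo (g \<circ> ?h) ?K"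
    have h: "inj ?h"
      by (intro sum.inj_map inj_skip)
    note sub = eo_subgraph_skip[OF mn]
    have C: "edge_ordered_graph ?C"
      using g h edge_ordered_graph_complete_bipartite_lex
      by (intro edge_ordered_graph_map_eo inj_compose)
    have "eo_subgraph ?C ?F"
      using sub unfolding map_eo_comp[symmetric]
      by (intro eo_subgraphI F C[folded map_eo_comp])
        (auto simp: eo_subgraph_def map_eo_def)
    then have "eo_copy ?C ?K ?F"
      using C eo_isomorphic_map_eo[OF inj_compose[OF g h], of ?K] by (simp add: eo_copy_def)
    moreover have "c e = Blue" if e: "e \<in> edges ?C" for e
    proof -
      obtain k where k: "k \<in> edges ?K" "e = g ` ?h ` k"
        using e by (auto simp: map_eo_def image_image)
      obtain i j where "k = {Inl i, Inr j}"
        using k(1) by (auto simp: complete_bipartite_lex_def)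
      then have ij: "e = g ` {Inl (skip m i), Inr (skip n j)}"
        "{Inl (skip m i), Inr (skip n j)} \<in> edges (map_eo ?h ?K)"
        using k imageI[OF k(1), of "(`) ?h"] by (simp_all add: map_eo_def)
      then have "{Inl (skip m i), Inr (skip n j)} \<in> edges ?Q"
        using sub by (auto simp: eo_subgraph_def)
      moreover have "(skip m i, skip n j) \<notin> R"
        using star skip_neq by auto
      ultimately have "c e \<noteq> Red"
        using ij by (auto simp: R_def)
      then show ?thesis by (cases "c e") auto
    qed
    ultimately show ?thesis by blast
  qed
qed

theorem theorem3p3:
  fixes s t :: nat and M :: "'a eograph"
  assumes "2 \<le> s" and "s \<le> t"
    and "is_2K2 M"
  shows "size_edge_ordered_ramsey M (complete_bipartite_lex s t) = enat (s * t + s + t)"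
proof -
  let ?F = "map_eo sum_encode (punctured_biclique s t)"
  let ?S = "{enat (card (edges F)) | F :: nat eograph.
    edge_ordered_graph F \<and> eo_arrows F M (complete_bipartite_lex s t)}"
  \<comment> \<open>The optimal host is moved to vertices in \<^typ>\<open>nat\<close>.\<close>
  have inj: "inj sum_encode"
    by (rule inj_sum_encode)
  have "card (edges ?F) = s * t + s + t"
  proof -
    have "inj_on ((`) sum_encode) (edges (punctured_biclique s t))"
      using inj by (simp add: inj_on_def inj_image_eq_iff)
    then show ?thesis
      by (simp add: map_eo_def card_image card_edges_punctured_biclique)
  qed
  moreover have "edge_ordered_graph ?F"
    using inj edge_ordered_graph_punctured_biclique by (rule edge_ordered_graph_map_eo)
  ultimately have "enat (s * t + s + t) \<in> ?S"
    using eo_arrows_punctured_biclique[OF inj assms(3), of s t]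
    by (intro CollectI exI[of _ ?F]) simp
  moreover have "enat (s * t + s + t) \<le> n" if "n \<in> ?S" for n
    using that card_edges_arrowing_ge[OF assms] by auto
  ultimately show ?thesis
    unfolding size_edge_ordered_ramsey_def
    by (intro antisym Inf_lower Inf_greatest)
qed

end
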